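(* Let $\mathcal H_1,\mathcal H_2,\mathcal G$ be real Hilbert spaces, $A:\mathcal H_1\to\mathcal G$ and $B:\mathcal H_2\to\mathcal G$ continuous linear maps, $b\in\mathcal G$, $\lambda>0$, and $f$, $g$ proper closed convex extended-real-valued functions on $\mathcal H_1$, $\mathcal H_2$, under the standing assumptions in the context. Let $(x_1^k,y_1^k,z_1^k)$ be generated by Algorithm 1 and $(y_4^k,u_4^k)$ by Algorithm 4 of the context, with the same $\lambda$. Suppose that the initializations satisfy $$Ax_1^0=\lambda(u_4^0-u_4^{-1})+b-By_4^0\qquad\text{and}\qquad z_1^0=u_4^0 .$$ Then Algorithms 1 and 4 are equivalent with the identities $$Ax_1^k=\lambda(u_4^k-u_4^{k-1})+b-By_4^k,\qquad z_1^k=u_4^k\qquad\text{for all }k>0 .$$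
   Context: $A^*$ is the adjoint of $A$, and $f^*(v)=\sup_x\{\langle v,x\rangle-f(x)\}$ is the convex conjugate. "Equivalent" means that the steps of one algorithm can be recovered from those of the other, here through the displayed identities. Algorithm 1 (ADM applied to: minimize $f(x)+g(y)$ subject to $Ax+By=b$): given $x_1^0,z_1^0$, for $k=0,1,\dots$: $y_1^{k+1}\in\arg\min_y g(y)+\frac1{2\lambda}\|Ax_1^k+By-b+\lambda z_1^k\|^2$; $x_1^{k+1}\in\arg\min_x f(x)+\frac1{2\lambda}\|Ax+By_1^{k+1}-b+\lambda z_1^k\|^2$; $z_1^{k+1}=z_1^k+\lambda^{-1}(Ax_1^{k+1}+By_1^{k+1}-b)$. Algorithm 4 (a primal-dual algorithm for the saddle-point problem $\min_y\max_u\ g(y)+\langle u,By-b\rangle-f^*(-A^*u)$): given $u_4^0,u_4^{-1},y_4^0$, for $k=0,1,\dots$: $\bar u_4^k=2u_4^k-u_4^{k-1}$; $y_4^{k+1}\in\arg\min_y g(y)+\frac1{2\lambda}\|By-By_4^k+\lambda\bar u_4^k\|^2$; $u_4^{k+1}=\arg\min_u f^*(-A^*u)-\langle u,By_4^{k+1}-b\rangle+\frac\lambda2\|u-u_4^k\|^2$. Standing assumptions: with $F(s)=\min_x\{f(x):Ax=s\}$ and $G(t)=\min_y\{g(y):By-b=t\}$ (value $+\infty$ if infeasible), all functions, including $F$ and $G$, are proper, closed and convex; these minima are attained wherever finite (in particular, all subproblems have solutions); saddle-point solutions exist. One has $F^*(u)=f^*(A^*u)$. When minimizers are not unique, any may be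 chosen. *)

theory Defs
  imports "HOL-Analysis.Analysis"
begin

text \<open>Extended-real-valued convex analysis. Convexity and closedness are expressed through the
  epigraph, which avoids adding infinities of opposite sign.\<close>

definition ereal_epigraph :: "('a \<Rightarrow> ereal) \<Rightarrow> ('a \<times> real) set" where
  "ereal_epigraph h = {(x, t). h x \<le> ereal t}"

definition proper_fun :: "('a \<Rightarrow> ereal) \<Rightarrow> bool" where
  "proper_fun h \<longleftrightarrow> (\<forall>x. h x \<noteq> -\<infinity>) \<and> (\<exists>x. h x \<noteq> \<infinity>)"

definition proper_closed_convex :: "('a::real_normed_vector \<Rightarrow> ereal) \<Rightarrow> bool" where
  "proper_closed_convex h \<longleftrightarrow>
     proper_fun h \<and> closed (ereal_epigraph h) \<and> convex (ereal_epigraph h)"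

definition conjugate :: "('a::real_inner \<Rightarrow> ereal) \<Rightarrow> 'a \<Rightarrow> ereal" where
  "conjugate h v = (SUP x. ereal (v \<bullet> x) - h x)"

definition Argmin :: "('a \<Rightarrow> ereal) \<Rightarrow> 'a set" where
  "Argmin h = {x. is_arg_min h (\<lambda>_. True) x}"

text \<open>\<open>marginal h L s\<close> is the infimum of \<open>h\<close> over the fibre of \<open>L\<close> above \<open>s\<close>; it is \<open>\<infinity>\<close> when the
  fibre is empty. The functions \<open>F\<close> and \<open>G\<close> of the splitting problem are \<open>marginal f A\<close> and
  \<open>marginal g (\<lambda>y. B y - b)\<close>.\<close>

definition marginal :: "('a \<Rightarrow> ereal) \<Rightarrow> ('a \<Rightarrow> 'c) \<Rightarrow> 'c \<Rightarrow> ereal" where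
  "marginal h L s = (INF x\<in>{x. L x = s}. h x)"

definition attained_where_finite :: "('a \<Rightarrow> ereal) \<Rightarrow> ('a \<Rightarrow> 'c) \<Rightarrow> bool" where
  "attained_where_finite h L \<longleftrightarrow>
     (\<forall>s. \<bar>marginal h L s\<bar> \<noteq> \<infinity> \<longrightarrow> (\<exists>x. L x = s \<and> h x = marginal h L s))"

text \<open>\<open>adjoint\<close> is defined by choice from \<open>A x \<bullet> u = x \<bullet> A' u\<close>; for bounded linear maps between
  Hilbert spaces such a map exists by the Riesz representation theorem.\<close>

definition saddle_fun ::
  "('a::real_inner \<Rightarrow> ereal) \<Rightarrow> ('b::real_inner \<Rightarrow> ereal) \<Rightarrow> ('a \<Rightarrow> 'c::real_inner) \<Rightarrow>
   ('b \<Rightarrow> 'c) \<Rightarrow> 'c \<Rightarrow> 'b \<Rightarrow> 'c \<Rightarrow> ereal" where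
  "saddle_fun f g A B b y u =
     g y + ereal (u \<bullet> (B y - b)) - conjugate f (- adjoint A u)"

text \<open>The finiteness conditions on the saddle point ensure that no difference \<open>\<infinity> - \<infinity>\<close> occurs
  in the two inequalities (\<open>f\<close> and \<open>g\<close> being proper).\<close>

definition is_saddle_point ::
  "('a::real_inner \<Rightarrow> ereal) \<Rightarrow> ('b::real_inner \<Rightarrow> ereal) \<Rightarrow> ('a \<Rightarrow> 'c::real_inner) \<Rightarrow>
   ('b \<Rightarrow> 'c) \<Rightarrow> 'c \<Rightarrow> 'b \<Rightarrow> 'c \<Rightarrow> bool" where
  "is_saddle_point f g A B b y u \<longleftrightarrow>
     \<bar>g y\<bar> \<noteq> \<infinity> \<and> \<bar>conjugate f (- adjoint A u)\<bar> \<noteq> \<infinity> \<and>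
     (\<forall>v. saddle_fun f g A B b y v \<le> saddle_fun f g A B b y u) \<and>
     (\<forall>w. saddle_fun f g A B b y u \<le> saddle_fun f g A B b w u)"

text \<open>The value \<open>y 0\<close> plays no role in the following definition.\<close>

definition ADM_run ::
  "('a::real_inner \<Rightarrow> ereal) \<Rightarrow> ('b::real_inner \<Rightarrow> ereal) \<Rightarrow> ('a \<Rightarrow> 'c::real_inner) \<Rightarrow>
   ('b \<Rightarrow> 'c) \<Rightarrow> 'c \<Rightarrow> real \<Rightarrow> 'a \<Rightarrow> 'c \<Rightarrow>
   (nat \<Rightarrow> 'a) \<Rightarrow> (nat \<Rightarrow> 'b) \<Rightarrow> (nat \<Rightarrow> 'c) \<Rightarrow> bool" where
  "ADM_run f g A B b lam x0 z0 x y z \<longleftrightarrow>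
     x 0 = x0 \<and> z 0 = z0 \<and>
     (\<forall>k.
        y (Suc k) \<in> Argmin (\<lambda>w. g w +
          ereal (1 / (2 * lam) * (norm (A (x k) + B w - b + lam *\<^sub>R z k))\<^sup>2)) \<and>
        x (Suc k) \<in> Argmin (\<lambda>v. f v +
          ereal (1 / (2 * lam) * (norm (A v + B (y (Suc k)) - b + lam *\<^sub>R z k))\<^sup>2)) \<and>
        z (Suc k) = z k + inverse lam *\<^sub>R (A (x (Suc k)) + B (y (Suc k)) - b))"

text \<open>\<open>prev um u k\<close> is the iterate with index \<open>k - 1\<close>, where \<open>um\<close> is the one with index \<open>-1\<close>.\<close>

definition prev :: "'c \<Rightarrow> (nat \<Rightarrow> 'c) \<Rightarrow> nat \<Rightarrow> 'c" where
  "prev um u k = (case k of 0 \<Rightarrow> um | Suc j \<Rightarrow> u j)"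

definition PD_run ::
  "('a::real_inner \<Rightarrow> ereal) \<Rightarrow> ('b::real_inner \<Rightarrow> ereal) \<Rightarrow> ('a \<Rightarrow> 'c::real_inner) \<Rightarrow>
   ('b \<Rightarrow> 'c) \<Rightarrow> 'c \<Rightarrow> real \<Rightarrow> 'c \<Rightarrow> 'c \<Rightarrow> 'b \<Rightarrow>
   (nat \<Rightarrow> 'b) \<Rightarrow> (nat \<Rightarrow> 'c) \<Rightarrow> bool" where
  "PD_run f g A B b lam u0 um y0 y u \<longleftrightarrow>
     u 0 = u0 \<and> y 0 = y0 \<and>
     (\<forall>k. let ubar = 2 *\<^sub>R u k - prev um u k in
        y (Suc k) \<in> Argmin (\<lambda>w. g w +
          ereal (1 / (2 * lam) * (norm (B w - B (y k) + lam *\<^sub>R ubar))\<^sup>2)) \<and>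
        {u (Suc k)} = Argmin (\<lambda>v. conjugate f (- adjoint A v)
          - ereal (v \<bullet> (B (y (Suc k)) - b)) + ereal (lam / 2 * (norm (v - u k))\<^sup>2)))"

end

theory Submission
  imports Defs
begin

text \<open>By Fermat's rule, a minimizer \<open>x\<close> of the primal subproblem of ADM makes the negative of the updated
  multiplier \<open>u' = u + (A x + B y - b) / lam\<close> a subgradient of \<open>F\<close> at \<open>A x\<close>. Inverting the subgradient
  relation, \<open>u'\<close> is the unique minimizer of the dual subproblem. The two \<open>y\<close>-subproblems coincide by the
  displayed identity at the previous step, and determine \<open>B y\<close> uniquely. To recover ADM from the
  primal-dual method the primal subproblem must have a solution: a saddle point gives \<open>F\<close> an affine
  minorant, so minimizing sequences of the strongly convex objective have finite limiting value and are Cauchy.\<close>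

section \<open>Epigraph convexity and minimizers of extended-real functions\<close>

text \<open>Real upper bounds \<open>a\<close>, \<open>b\<close> in place of function values give
  Jensen's inequality without infinite sums.\<close>

lemma proper_closed_convexD:
  assumes "proper_closed_convex h" "h x \<le> ereal a" "h y \<le> ereal b" "0 \<le> t" "t \<le> 1"
  shows "h ((1 - t) *\<^sub>R x + t *\<^sub>R y) \<le> ereal ((1 - t) * a + t * b)"
proof -
  have "convex (ereal_epigraph h)" "(x, a) \<in> ereal_epigraph h" "(y, b) \<in> ereal_epigraph h"
    using assms by (auto simp: proper_closed_convex_def ereal_epigraph_def)
  then have "(1 - t) *\<^sub>R (x, a) + t *\<^sub>R (y, b) \<in> ereal_epigraph h"
    using assms(4,5) by (intro convexD) auto
  then show ?thesis
    by (simp add: ereal_epigraph_def)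
qed

lemma Argmin_iff: "x \<in> Argmin h \<longleftrightarrow> (\<forall>y. h x \<le> h y)"
  by (auto simp: Argmin_def is_arg_min_def not_less)

lemma proper_fun_not_minus_infinity: "proper_fun h \<Longrightarrow> h x \<noteq> -\<infinity>"
  by (simp add: proper_fun_def)

lemma proper_funE:
  assumes "proper_fun h"
  obtains x a where "h x = ereal a"
  using assms unfolding proper_fun_def by (metis ereal_cases)

lemma norm_add_scaleR_power2:
  fixes x y :: "'a::real_inner"
  shows "(norm (x + t *\<^sub>R y))\<^sup>2 = (norm x)\<^sup>2 + 2 * t * (x \<bullet> y) + t\<^sup>2 * (norm y)\<^sup>2"
  unfolding power2_norm_eq_inner
  by (simp add: inner_add_left inner_add_right inner_commute power2_eq_square)

section \<open>Existence of proximal points\<close>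

text \<open>Direct method: strong convexity makes a minimizing sequence Cauchy, so completeness
  replaces compactness, and the closed epigraph carries the estimate to the limit.\<close>

lemma Argmin_quadratic_nonempty:
  fixes h :: "'c::{real_inner, complete_space} \<Rightarrow> ereal"
  assumes h: "proper_closed_convex h" and lam: "lam > 0"
    and bound: "\<And>s. ereal m \<le> h s + ereal (1 / (2 * lam) * (norm (s + c))\<^sup>2)"
  obtains s where "s \<in> Argmin (\<lambda>v. h v + ereal (1 / (2 * lam) * (norm (v + c))\<^sup>2))"
proof -
  define q where "q s = 1 / (2 * lam) * (norm (s + c))\<^sup>2" for s
  \<comment> \<open>Ranging over epigraph heights \<open>t\<close> instead of values of
    \<open>h\<close> makes \<open>S\<close> a set of reals, bounded below by \<open>m\<close>, with
    a real infimum.\<close>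
  define S where "S = {t + q s | s t. h s \<le> ereal t}"
  define i where "i = Inf S"
  have proper: "proper_fun h" and closed: "closed (ereal_epigraph h)"
    using h by (auto simp: proper_closed_convex_def)
  have S_ne: "S \<noteq> {}"
    using proper_funE[OF proper] unfolding S_def by (metis (mono_tags, lifting) empty_iff mem_Collect_eq order_refl)
  have S_bdd: "bdd_below S"
  proof (rule bdd_belowI)
    fix r assume "r \<in> S"
    then obtain s t where r: "r = t + q s" and "h s \<le> ereal t"
      by (auto simp: S_def)
    then have "h s + ereal (q s) \<le> ereal r"
      by (metis add_right_mono plus_ereal.simps(1))
    then have "ereal m \<le> ereal r"
      using bound[of s] unfolding q_def by (rule order_trans[rotated])
    then show "m \<le> r" by simp
  qed
  have i_le: "i \<le> t + q s" if "h s \<le> ereal t" for s t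
    unfolding i_def using that S_bdd by (intro cInf_lower) (auto simp: S_def)
  have "\<exists>s t. h s \<le> ereal t \<and> t + q s < i + 1 / real (Suc n)" for n
  proof -
    have "\<exists>r\<in>S. r < i + 1 / real (Suc n)"
      using cInf_lessD[OF S_ne, of "i + 1 / real (Suc n)"] by (auto simp: i_def)
    then show ?thesis by (auto simp: S_def)
  qed
  then obtain s t where st: "\<And>n. h (s n) \<le> ereal (t n)"
    and st_less: "\<And>n. t n + q (s n) < i + 1 / real (Suc n)"
    by metis
  \<comment> \<open>Parallelogram law; the midpoint is written as in
    \<open>proper_closed_convexD\<close> with weight 1/2.\<close>
  have q_mid: "q ((1 - 1/2) *\<^sub>R x + (1/2) *\<^sub>R y) = (q x + q y) / 2 - (norm (x - y))\<^sup>2 / (8 * lam)" for x y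
  proof -
    have "(norm ((1 - 1/2) *\<^sub>R x + (1/2) *\<^sub>R y + c))\<^sup>2
        = ((norm (x + c))\<^sup>2 + (norm (y + c))\<^sup>2) / 2 - (norm (x - y))\<^sup>2 / 4"
      unfolding power2_norm_eq_inner
      by (simp add: inner_add_left inner_add_right inner_diff_left inner_diff_right
          inner_commute field_simps)
    then show ?thesis unfolding q_def using lam by (simp only:) (simp add: field_simps)
  qed
  have close: "(norm (s n - s k))\<^sup>2 \<le> 4 * lam * (1 / real (Suc n) + 1 / real (Suc k))" for n k
  proof -
    have "h ((1 - 1/2) *\<^sub>R s n + (1/2) *\<^sub>R s k) \<le> ereal ((1 - 1/2) * t n + 1/2 * t k)"
      by (rule proper_closed_convexD[OF h st st]) auto
    from i_le[OF this] have "(norm (s n - s k))\<^sup>2 / (8 * lam)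
        \<le> (t n + q (s n)) / 2 + (t k + q (s k)) / 2 - i"
      unfolding q_mid by (simp add: field_simps)
    also have "\<dots> \<le> (1 / real (Suc n) + 1 / real (Suc k)) / 2"
      using st_less[of n] st_less[of k] by argo
    finally have "(norm (s n - s k))\<^sup>2 \<le> (1 / real (Suc n) + 1 / real (Suc k)) / 2 * (8 * lam)"
      using lam by (subst (asm) pos_divide_le_eq) auto
    then show ?thesis by argo
  qed
  have "Cauchy s"
  proof (rule metric_CauchyI)
    fix e :: real assume e: "e > 0"
    obtain N where N: "1 / real (Suc N) < e\<^sup>2 / (8 * lam)"
      using e lam nat_approx_posE[of "e\<^sup>2 / (8 * lam)"] by auto
    have "dist (s n) (s k) < e" if "n \<ge> N" "k \<ge> N" for n k
    proof -
      have "1 / real (Suc n) \<le> 1 / real (Suc N)" "1 / real (Suc k) \<le> 1 / real (Suc N)"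
        using that by (simp_all add: frac_le)
      then have "1 / real (Suc n) + 1 / real (Suc k) < 2 * (e\<^sup>2 / (8 * lam))"
        using N by linarith
      then have "4 * lam * (1 / real (Suc n) + 1 / real (Suc k)) < 4 * lam * (2 * (e\<^sup>2 / (8 * lam)))"
        using lam by (intro mult_strict_left_mono) auto
      with close[of n k] have "(norm (s n - s k))\<^sup>2 < e\<^sup>2"
        using lam by (simp add: field_simps)
      then show ?thesis
        using e by (simp add: dist_norm power2_less_imp_less)
    qed
    then show "\<exists>N. \<forall>m\<ge>N. \<forall>n\<ge>N. dist (s m) (s n) < e" by blast
  qed
  then obtain s' where lim: "s \<longlonglongrightarrow> s'"
    using Cauchy_convergent convergent_def by blast
  have q_lim: "(\<lambda>n. q (s n)) \<longlonglongrightarrow> q s'"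
    unfolding q_def by (intro tendsto_intros lim)
  \<comment> \<open>Convergence of the heights \<open>t\<close> is not known directly; it follows by
    subtracting the limit of the continuous part \<open>q\<close> from that of the sum.\<close>
  have "(\<lambda>n. t n + q (s n)) \<longlonglongrightarrow> i"
  proof (rule tendsto_sandwich)
    show "\<forall>\<^sub>F n in sequentially. i \<le> t n + q (s n)"
      using i_le st by simp
    show "\<forall>\<^sub>F n in sequentially. t n + q (s n) \<le> i + 1 / real (Suc n)"
      using st_less by (simp add: less_imp_le)
    show "(\<lambda>n. i + 1 / real (Suc n)) \<longlonglongrightarrow> i"
      using tendsto_add[OF tendsto_const LIMSEQ_inverse_real_of_nat, of i]
      by (simp add: inverse_eq_divide)
  qed simp
  from tendsto_diff[OF this q_lim] have "t \<longlonglongrightarrow> i - q s'" by simp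
  then have st_lim: "(\<lambda>n. (s n, t n)) \<longlonglongrightarrow> (s', i - q s')"
    by (intro tendsto_Pair lim)
  have "(s n, t n) \<in> ereal_epigraph h" for n
    using st by (simp add: ereal_epigraph_def)
  from closed_sequentially[OF closed this st_lim]
  have "(s', i - q s') \<in> ereal_epigraph h" .
  then have s': "h s' + ereal (q s') \<le> ereal i"
    by (cases "h s'") (auto simp: ereal_epigraph_def)
  have "ereal i \<le> h v + ereal (q v)" for v
    using i_le[of v] proper_fun_not_minus_infinity[OF proper, of v] by (cases "h v") auto
  with s' have "s' \<in> Argmin (\<lambda>v. h v + ereal (q v))"
    unfolding Argmin_iff by (meson order_trans)
  then show ?thesis using that unfolding q_def by blast
qed

section \<open>First-order optimality for quadratically perturbed functions\<close>

lemma Argmin_finite: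
  assumes "proper_fun h" "x \<in> Argmin (\<lambda>v. h v + ereal (q v))"
  obtains a where "h x = ereal a"
proof -
  obtain y b where "h y = ereal b" using proper_funE[OF assms(1)] .
  with assms(2) have "h x + ereal (q x) \<le> ereal (b + q y)"
    unfolding Argmin_iff by (metis plus_ereal.simps(1))
  then show ?thesis
    using that proper_fun_not_minus_infinity[OF assms(1), of x] by (cases "h x") auto
qed

text \<open>Let \<open>t\<close> decrease to 0; this discards the second-order term when a minimizer
  is compared with points of a segment.\<close>

lemma nonneg_if_nonneg_add_mult:
  fixes p q :: real
  assumes "\<And>t. 0 < t \<Longrightarrow> t \<le> 1 \<Longrightarrow> 0 \<le> p + t * q"
  shows "0 \<le> p"
proof (rule tendsto_lowerbound)
  show "((\<lambda>t. p + t * q) \<longlongrightarrow> p) (at_right 0)"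
    by (auto intro!: tendsto_eq_intros)
  show "\<forall>\<^sub>F t in at_right 0. 0 \<le> p + t * q"
    using assms by (auto intro!: eventually_at_rightI[of 0 1])
qed simp

text \<open>Fermat's rule: \<open>- (L x + c) / lam\<close> is a subgradient of the marginal of \<open>h\<close> at \<open>L x\<close>.\<close>

lemma Argmin_quadratic_subgradient:
  fixes h :: "'a::real_normed_vector \<Rightarrow> ereal" and L :: "'a \<Rightarrow> 'c::real_inner"
  assumes h: "proper_closed_convex h" and L: "linear L" and lam: "lam > 0"
    and x: "x \<in> Argmin (\<lambda>v. h v + ereal (1 / (2 * lam) * (norm (L v + c))\<^sup>2))"
  shows "h x + ereal ((inverse lam *\<^sub>R (L x + c)) \<bullet> (L x - L v)) \<le> h v"
proof -
  have proper: "proper_fun h" using h by (simp add: proper_closed_convex_def)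
  obtain a where a: "h x = ereal a" using Argmin_finite[OF proper x] .
  show ?thesis
  proof (cases "h v")
    case (real r)
    define p where "p = L x + c"
    define d where "d = L v - L x"
    \<comment> \<open>The objective at \<open>x\<close> is compared with an upper bound at the point
      \<open>w\<close> of the segment towards \<open>v\<close>, and the difference is divided by
      \<open>t\<close>.\<close>
    have "0 \<le> (r - a + inverse lam * (p \<bullet> d)) + t * (1 / (2 * lam) * (norm d)\<^sup>2)"
      if t: "0 < t" "t \<le> 1" for t
    proof -
      define w where "w = (1 - t) *\<^sub>R x + t *\<^sub>R v"
      have "h w \<le> ereal ((1 - t) * a + t * r)"
        unfolding w_def by (rule proper_closed_convexD[OF h]) (use a real t in auto)
      then have "h w + ereal (1 / (2 * lam) * (norm (L w + c))\<^sup>2)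
          \<le> ereal ((1 - t) * a + t * r) + ereal (1 / (2 * lam) * (norm (L w + c))\<^sup>2)"
        by (rule add_right_mono)
      moreover have "h x + ereal (1 / (2 * lam) * (norm (L x + c))\<^sup>2)
          \<le> h w + ereal (1 / (2 * lam) * (norm (L w + c))\<^sup>2)"
        using x unfolding Argmin_iff by blast
      ultimately have "ereal a + ereal (1 / (2 * lam) * (norm (L x + c))\<^sup>2)
          \<le> ereal ((1 - t) * a + t * r) + ereal (1 / (2 * lam) * (norm (L w + c))\<^sup>2)"
        unfolding a by (rule order_trans[rotated])
      moreover have "L w + c = p + t *\<^sub>R d"
        by (simp add: w_def p_def d_def linear_add[OF L] linear_diff[OF L] linear_scale[OF L] algebra_simps)
      ultimately have "a + 1 / (2 * lam) * (norm p)\<^sup>2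
          \<le> (1 - t) * a + t * r + 1 / (2 * lam) * (norm (p + t *\<^sub>R d))\<^sup>2"
        by (simp add: p_def)
      then have "0 \<le> t * (r - a) + 1 / (2 * lam) * (2 * t * (p \<bullet> d) + t\<^sup>2 * (norm d)\<^sup>2)"
        unfolding norm_add_scaleR_power2 by (simp add: algebra_simps)
      also have "\<dots> = t * ((r - a + inverse lam * (p \<bullet> d)) + t * (1 / (2 * lam) * (norm d)\<^sup>2))"
        using lam by (simp add: field_simps power2_eq_square)
      finally show ?thesis using t by (simp add: zero_le_mult_iff)
    qed
    then have "0 \<le> r - a + inverse lam * (p \<bullet> d)"
      by (rule nonneg_if_nonneg_add_mult)
    moreover have "L x - L v = - d" by (simp add: d_def)
    ultimately show ?thesis by (simp add: a real p_def)
  qed (use proper_fun_not_minus_infinity[OF proper] in auto)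
qed

text \<open>Adding the subgradient inequalities at the two minimizers, each tested at the other,
  leaves the squared distance of the images. The quadratic sees a point only through
  \<open>L\<close>, so only images are determined.\<close>

lemma Argmin_quadratic_image_unique:
  fixes h :: "'a::real_normed_vector \<Rightarrow> ereal" and L :: "'a \<Rightarrow> 'c::real_inner"
  assumes h: "proper_closed_convex h" and L: "linear L" and lam: "lam > 0"
    and x: "x \<in> Argmin (\<lambda>v. h v + ereal (1 / (2 * lam) * (norm (L v + c))\<^sup>2))"
    and y: "y \<in> Argmin (\<lambda>v. h v + ereal (1 / (2 * lam) * (norm (L v + c))\<^sup>2))"
  shows "L x = L y"
proof -
  have proper: "proper_fun h" using h by (simp add: proper_closed_convex_def)
  obtain a where a: "h x = ereal a" using Argmin_finite[OF proper x] .
  obtain b where b: "h y = ereal b" using Argmin_finite[OF proper y] .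
  have "inverse lam * ((L x + c) \<bullet> (L x - L y)) + inverse lam * ((L y + c) \<bullet> (L y - L x)) \<le> 0"
    using Argmin_quadratic_subgradient[OF h L lam x, of y]
      Argmin_quadratic_subgradient[OF h L lam y, of x] by (simp add: a b)
  also have "inverse lam * ((L x + c) \<bullet> (L x - L y)) + inverse lam * ((L y + c) \<bullet> (L y - L x))
      = inverse lam * (norm (L x - L y))\<^sup>2"
    unfolding power2_norm_eq_inner by (simp add: inner_diff_left inner_add_left inner_diff_right algebra_simps)
  finally show ?thesis using lam by (simp add: mult_le_0_iff)
qed

section \<open>Riesz representation, the adjoint and the conjugate\<close>

text \<open>The representing vector is the minimizer of \<open>\<parallel>x\<parallel>\<^sup>2 / 2 - \<phi> x\<close>.\<close>

lemma Riesz_representation: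
  fixes \<phi> :: "'a::{real_inner, complete_space} \<Rightarrow> real"
  assumes "bounded_linear \<phi>"
  obtains v where "\<And>x. \<phi> x = x \<bullet> v"
proof -
  interpret \<phi>: bounded_linear \<phi> by fact
  define h where "h x = ereal (- \<phi> x)" for x
  obtain K where K: "\<And>x. norm (\<phi> x) \<le> norm x * K" using \<phi>.bounded by blast
  have epi: "ereal_epigraph h = {p. - \<phi> (fst p) \<le> snd p}"
    by (auto simp: ereal_epigraph_def h_def)
  have "closed (ereal_epigraph h)"
    unfolding epi by (intro closed_Collect_le continuous_intros \<phi>.continuous_on)
  moreover have "convex (ereal_epigraph h)"
  proof (rule convexI)
    fix p r and u w :: real
    assume "p \<in> ereal_epigraph h" "r \<in> ereal_epigraph h" and uw: "0 \<le> u" "0 \<le> w" "u + w = 1"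
    then have "u * - \<phi> (fst p) + w * - \<phi> (fst r) \<le> u * snd p + w * snd r"
      unfolding epi by (intro add_mono mult_left_mono) auto
    then show "u *\<^sub>R p + w *\<^sub>R r \<in> ereal_epigraph h"
      unfolding epi by (simp add: \<phi>.add \<phi>.scaleR)
  qed
  ultimately have h: "proper_closed_convex h"
    by (auto simp: proper_closed_convex_def proper_fun_def h_def)
  \<comment> \<open>Completing the square in \<open>norm s - K\<close>. The unsimplified
    \<open>1 / (2 * 1)\<close> and \<open>s + 0\<close> match the proximal lemmas with
    \<open>lam = 1\<close> and \<open>c = 0\<close>.\<close>
  have "ereal (- (K\<^sup>2 / 2)) \<le> h s + ereal (1 / (2 * 1) * (norm (s + 0))\<^sup>2)" for s
  proof -
    have "0 \<le> (norm s - K)\<^sup>2" by simp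
    then have "norm s * K \<le> (norm s)\<^sup>2 / 2 + K\<^sup>2 / 2"
      by (simp add: power2_diff)
    moreover have "\<phi> s \<le> norm s * K" using K[of s] by simp
    ultimately show ?thesis by (simp add: h_def)
  qed
  then obtain v where v: "v \<in> Argmin (\<lambda>s. h s + ereal (1 / (2 * 1) * (norm (s + 0))\<^sup>2))"
    using Argmin_quadratic_nonempty[OF h zero_less_one] by blast
  have le: "\<phi> d \<le> d \<bullet> v" for d
    using Argmin_quadratic_subgradient[where L = "\<lambda>x. x", OF h _ zero_less_one v, of "v + d"]
    by (simp add: h_def \<phi>.add linear_id[unfolded id_def] inner_commute)
  \<comment> \<open>Both sides are odd in \<open>d\<close>, so the inequality at \<open>d\<close>
    and \<open>- d\<close> is an equality.\<close>
  have "\<phi> d = d \<bullet> v" for d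
    using le[of d] le[of "- d"] by (simp add: \<phi>.neg)
  then show ?thesis by (rule that)
qed

text \<open>Riesz representation of \<open>\<lambda>x. A x \<bullet> u\<close> for each
  \<open>u\<close> provides a witness, so the choice defining \<open>adjoint\<close> meets its
  specification.\<close>

lemma adjoint_bounded_linear:
  fixes A :: "'a::{real_inner, complete_space} \<Rightarrow> 'c::real_inner"
  assumes "bounded_linear A"
  shows "A x \<bullet> u = x \<bullet> adjoint A u"
proof -
  have "\<exists>v. \<forall>x. A x \<bullet> u = x \<bullet> v" for u
  proof -
    have "bounded_linear (\<lambda>x. A x \<bullet> u)"
      using bounded_linear_compose[OF bounded_linear_inner_left assms] .
    then show ?thesis using Riesz_representation by metis
  qed
  then have "\<exists>A'. \<forall>x u. A x \<bullet> u = x \<bullet> A' u" by metis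
  then have "\<forall>x u. A x \<bullet> u = x \<bullet> adjoint A u"
    unfolding adjoint_def by (rule someI_ex)
  then show ?thesis by blast
qed

text \<open>Removes the adjoint from the dual function; grouping the supremum by fibres of
  \<open>A\<close> shows it to be the conjugate of \<open>marginal f A\<close> at
  \<open>- u\<close>.\<close>

lemma conjugate_neg_adjoint:
  fixes A :: "'a::{real_inner, complete_space} \<Rightarrow> 'c::real_inner"
  assumes "bounded_linear A"
  shows "conjugate f (- adjoint A u) = (SUP x. ereal (- (u \<bullet> A x)) - f x)"
  unfolding conjugate_def using adjoint_bounded_linear[OF assms]
  by (simp add: inner_commute)

lemma Fenchel_Young_neg_adjoint:
  fixes A :: "'a::{real_inner, complete_space} \<Rightarrow> 'c::real_inner"
  assumes "bounded_linear A"
  shows "ereal (- (u \<bullet> A x)) - f x \<le> conjugate f (- adjoint A u)"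
  unfolding conjugate_neg_adjoint[OF assms] by (rule SUP_upper) simp

section \<open>The dual and primal subproblems\<close>

text \<open>Moreau's identity: the primal proximal step determines the dual one. The vector \<open>A x\<close> is a
  subgradient of \<open>v \<mapsto> f\<^sup>*(- A\<^sup>* v)\<close>, up to sign, at the updated multiplier, so the dual objective
  exceeds its value there by at least \<open>lam / 2 * \<parallel>v - u'\<parallel>\<^sup>2\<close>.\<close>

lemma Argmin_dual_step:
  fixes A :: "'a::{real_inner, complete_space} \<Rightarrow> 'c::real_inner"
  assumes A: "bounded_linear A" and lam: "lam > 0" and f: "proper_closed_convex f"
    and x: "x \<in> Argmin (\<lambda>v. f v + ereal (1 / (2 * lam) * (norm (A v + c + lam *\<^sub>R u))\<^sup>2))"
  shows "Argmin (\<lambda>v. conjugate f (- adjoint A v) - ereal (v \<bullet> c) + ereal (lam / 2 * (norm (v - u))\<^sup>2))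
    = {u + inverse lam *\<^sub>R (A x + c)}"
proof -
  define J where "J v = conjugate f (- adjoint A v) - ereal (v \<bullet> c) + ereal (lam / 2 * (norm (v - u))\<^sup>2)" for v
  define u' where "u' = u + inverse lam *\<^sub>R (A x + c)"
  have x': "x \<in> Argmin (\<lambda>v. f v + ereal (1 / (2 * lam) * (norm (A v + (c + lam *\<^sub>R u)))\<^sup>2))"
    using x by (simp add: add.assoc)
  have proper: "proper_fun f" using f by (simp add: proper_closed_convex_def)
  obtain a where a: "f x = ereal a" using Argmin_finite[OF proper x] .
  have u': "inverse lam *\<^sub>R (A x + (c + lam *\<^sub>R u)) = u'"
    using lam by (simp add: u'_def algebra_simps)
  have subgradient: "ereal (a + u' \<bullet> (A x - A v)) \<le> f v" for v
    using Argmin_quadratic_subgradient[OF f bounded_linear.linear[OF A] lam x', of v]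
    unfolding u' a by simp
  have "ereal (- (u' \<bullet> A v)) - f v \<le> ereal (- (u' \<bullet> A x) - a)" for v
    using subgradient[of v] by (cases "f v") (auto simp: inner_diff_right)
  \<comment> \<open>At \<open>u'\<close> the point \<open>x\<close> maximizes in the supremum; with
    \<open>conj_ge\<close> this makes the real minorant of \<open>J\<close> exact at
    \<open>u'\<close>.\<close>
  then have conj_u': "conjugate f (- adjoint A u') \<le> ereal (- (u' \<bullet> A x) - a)"
    unfolding conjugate_neg_adjoint[OF A] by (rule SUP_least)
  have conj_ge: "ereal (- (v \<bullet> A x) - a) \<le> conjugate f (- adjoint A v)" for v
    using Fenchel_Young_neg_adjoint[OF A, of v x f] by (simp add: a)
  have J_u': "J u' \<le> ereal (- (u' \<bullet> A x) - a - u' \<bullet> c + lam / 2 * (norm (u' - u))\<^sup>2)"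
    using conj_u' unfolding J_def by (cases "conjugate f (- adjoint A u')") auto
  have J_ge: "ereal (- (v \<bullet> A x) - a - v \<bullet> c + lam / 2 * (norm (v - u))\<^sup>2) \<le> J v" for v
    using conj_ge[of v] unfolding J_def by (cases "conjugate f (- adjoint A v)") auto
  \<comment> \<open>The minorant is a quadratic in \<open>v\<close>; eliminating \<open>c\<close>
    through the definition of \<open>u'\<close> cancels its linear part around
    \<open>u'\<close>.\<close>
  have eq: "- (v \<bullet> A x) - a - v \<bullet> c + lam / 2 * (norm (v - u))\<^sup>2
      = - (u' \<bullet> A x) - a - u' \<bullet> c + lam / 2 * (norm (u' - u))\<^sup>2 + lam / 2 * (norm (v - u'))\<^sup>2" for v
  proof -
    have c: "c = lam *\<^sub>R (u' - u) - A x" using lam by (simp add: u'_def)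
    show ?thesis
      unfolding c power2_norm_eq_inner
      by (simp add: inner_diff_left inner_diff_right inner_add_left inner_add_right inner_commute field_simps)
  qed
  have J_mono: "J u' \<le> J v" for v
  proof -
    have "- (u' \<bullet> A x) - a - u' \<bullet> c + lam / 2 * (norm (u' - u))\<^sup>2
        \<le> - (v \<bullet> A x) - a - v \<bullet> c + lam / 2 * (norm (v - u))\<^sup>2"
      unfolding eq[of v] using lam by simp
    then show ?thesis using J_u' J_ge[of v] by (meson ereal_less_eq(3) order_trans)
  qed
  have J_unique: "v = u'" if "J v \<le> J u'" for v
  proof -
    have "- (v \<bullet> A x) - a - v \<bullet> c + lam / 2 * (norm (v - u))\<^sup>2
        \<le> - (u' \<bullet> A x) - a - u' \<bullet> c + lam / 2 * (norm (u' - u))\<^sup>2"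
      using J_u' J_ge[of v] that by (meson ereal_less_eq(3) order_trans)
    then have "lam / 2 * (norm (v - u'))\<^sup>2 \<le> 0"
      unfolding eq[of v] by simp
    then show ?thesis using lam by (simp add: mult_le_0_iff)
  qed
  have "Argmin J = {u'}"
    using J_mono J_unique by (auto simp: Argmin_iff)
  then show ?thesis by (simp add: J_def[abs_def] u'_def)
qed

text \<open>Minimize first over the image: \<open>marginal f A\<close> plus the quadratic has a
  minimizer \<open>s\<close>, which attainment lifts to a point of the fibre. The finite dual value
  at \<open>u\<close> supplies the lower bound.\<close>

lemma Argmin_primal_step_nonempty:
  fixes A :: "'a::{real_inner, complete_space} \<Rightarrow> 'c::{real_inner, complete_space}"
  assumes A: "bounded_linear A" and lam: "lam > 0"
    and F: "proper_closed_convex (marginal f A)" and att: "attained_where_finite f A"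
    and fin: "\<bar>conjugate f (- adjoint A u)\<bar> \<noteq> \<infinity>"
  obtains x where "x \<in> Argmin (\<lambda>v. f v + ereal (1 / (2 * lam) * (norm (A v + c))\<^sup>2))"
proof -
  obtain r where r: "conjugate f (- adjoint A u) = ereal r" using fin by auto
  have f_ge: "ereal (- (u \<bullet> A x) - r) \<le> f x" for x
    using Fenchel_Young_neg_adjoint[OF A, of u x f] unfolding r by (cases "f x") auto
  then have F_ge: "ereal (- (u \<bullet> s) - r) \<le> marginal f A s" for s
    unfolding marginal_def by (auto intro!: INF_greatest)
  have F_le: "marginal f A (A x) \<le> f x" for x
    unfolding marginal_def by (rule INF_lower) simp
  \<comment> \<open>The constant is the minimum of the affine minorant
    \<open>- (u \<bullet> s) - r\<close> plus the quadratic, reached where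
    \<open>s + c = lam *\<^sub>R u\<close>.\<close>
  have "ereal (u \<bullet> c - r - lam / 2 * (norm u)\<^sup>2)
      \<le> marginal f A s + ereal (1 / (2 * lam) * (norm (s + c))\<^sup>2)" for s
  proof -
    have "0 \<le> 1 / (2 * lam) * (norm ((s + c) + (- lam) *\<^sub>R u))\<^sup>2"
      using lam by simp
    also have "\<dots> = 1 / (2 * lam) * (norm (s + c))\<^sup>2 - u \<bullet> s - u \<bullet> c + lam / 2 * (norm u)\<^sup>2"
      unfolding norm_add_scaleR_power2 using lam
      by (simp add: field_simps power2_eq_square inner_add_left inner_add_right inner_commute)
    finally have "u \<bullet> c - r - lam / 2 * (norm u)\<^sup>2
        \<le> - (u \<bullet> s) - r + 1 / (2 * lam) * (norm (s + c))\<^sup>2" by simp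
    then have "ereal (u \<bullet> c - r - lam / 2 * (norm u)\<^sup>2)
        \<le> ereal (- (u \<bullet> s) - r) + ereal (1 / (2 * lam) * (norm (s + c))\<^sup>2)" by simp
    also have "\<dots> \<le> marginal f A s + ereal (1 / (2 * lam) * (norm (s + c))\<^sup>2)"
      by (intro add_right_mono F_ge)
    finally show ?thesis .
  qed
  then obtain s where s: "s \<in> Argmin (\<lambda>v. marginal f A v + ereal (1 / (2 * lam) * (norm (v + c))\<^sup>2))"
    using Argmin_quadratic_nonempty[OF F lam] by blast
  have "proper_fun (marginal f A)" using F by (simp add: proper_closed_convex_def)
  then obtain a where "marginal f A s = ereal a" using Argmin_finite[OF _ s] by blast
  then have "\<bar>marginal f A s\<bar> \<noteq> \<infinity>" by simp
  then obtain x where x: "A x = s" "f x = marginal f A s"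
    using att unfolding attained_where_finite_def by metis
  have "f x + ereal (1 / (2 * lam) * (norm (A x + c))\<^sup>2)
      \<le> f v + ereal (1 / (2 * lam) * (norm (A v + c))\<^sup>2)" for v
  proof -
    have "f x + ereal (1 / (2 * lam) * (norm (A x + c))\<^sup>2)
        \<le> marginal f A (A v) + ereal (1 / (2 * lam) * (norm (A v + c))\<^sup>2)"
      using s unfolding Argmin_iff x by blast
    also have "\<dots> \<le> f v + ereal (1 / (2 * lam) * (norm (A v + c))\<^sup>2)"
      by (intro add_right_mono F_le)
    finally show ?thesis .
  qed
  then show ?thesis using that unfolding Argmin_iff by blast
qed

section \<open>Equivalence of the two methods\<close>

text \<open>Minimizers need not be unique, so equivalence has two aspects: arbitrary pairs of runs
  are related by the identities, and each run can be converted into one of the other method.\<close>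

theorem theorem2:
  fixes A :: "'a::{real_inner, complete_space} \<Rightarrow> 'c::{real_inner, complete_space}"
    and B :: "'b::{real_inner, complete_space} \<Rightarrow> 'c"
    and b :: 'c and lam :: real
    and f :: "'a \<Rightarrow> ereal" and g :: "'b \<Rightarrow> ereal"
    and x0 :: 'a and z0 u0 um :: 'c and y0 :: 'b
  assumes "bounded_linear A" and "bounded_linear B" and "lam > 0"
    and "proper_closed_convex f" and "proper_closed_convex g"
    and "proper_closed_convex (marginal f A)"
    and "proper_closed_convex (marginal g (\<lambda>y. B y - b))"
    and "attained_where_finite f A"
    and "attained_where_finite g (\<lambda>y. B y - b)"
    and "\<exists>y u. is_saddle_point f g A B b y u"
    and "A x0 = lam *\<^sub>R (u0 - um) + b - B y0" and "z0 = u0"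
  shows
    "(\<forall>x1 y1 z1 y4 u4.
        ADM_run f g A B b lam x0 z0 x1 y1 z1 \<and> PD_run f g A B b lam u0 um y0 y4 u4 \<longrightarrow>
        (\<forall>k>0. A (x1 k) = lam *\<^sub>R (u4 k - u4 (k - 1)) + b - B (y4 k) \<and> z1 k = u4 k)) \<and>
     (\<forall>x1 y1 z1.
        ADM_run f g A B b lam x0 z0 x1 y1 z1 \<longrightarrow>
        (\<exists>y4 u4. PD_run f g A B b lam u0 um y0 y4 u4 \<and>
           (\<forall>k>0. y4 k = y1 k \<and>
              A (x1 k) = lam *\<^sub>R (u4 k - u4 (k - 1)) + b - B (y4 k) \<and> z1 k = u4 k))) \<and>
     (\<forall>y4 u4.
        PD_run f g A B b lam u0 um y0 y4 u4 \<longrightarrow>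
        (\<exists>x1 y1 z1. ADM_run f g A B b lam x0 z0 x1 y1 z1 \<and>
           (\<forall>k>0. y1 k = y4 k \<and>
              A (x1 k) = lam *\<^sub>R (u4 k - u4 (k - 1)) + b - B (y4 k) \<and> z1 k = u4 k)))"
proof -
  note A = assms(1) and B = assms(2) and lam = assms(3) and f = assms(4) and g = assms(5)
  \<comment> \<open>Both \<open>y\<close>-subproblems have this form, so comparing them reduces to
    comparing the shifts \<open>p\<close>.\<close>
  define Ystep where
    "Ystep p = Argmin (\<lambda>w. g w + ereal (1 / (2 * lam) * (norm (B w + p))\<^sup>2))" for p
  define Xstep where
    "Xstep y u = Argmin (\<lambda>v. f v + ereal (1 / (2 * lam) * (norm (A v + B y - b + lam *\<^sub>R u))\<^sup>2))" for y u
  define Ustep where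
    "Ustep y u = Argmin (\<lambda>v. conjugate f (- adjoint A v) - ereal (v \<bullet> (B y - b))
      + ereal (lam / 2 * (norm (v - u))\<^sup>2))" for y u
  have ADM: "ADM_run f g A B b lam x0 z0 x y z \<longleftrightarrow> x 0 = x0 \<and> z 0 = u0 \<and>
      (\<forall>k. y (Suc k) \<in> Ystep (A (x k) - b + lam *\<^sub>R z k) \<and> x (Suc k) \<in> Xstep (y (Suc k)) (z k) \<and>
        z (Suc k) = z k + inverse lam *\<^sub>R (A (x (Suc k)) + B (y (Suc k)) - b))" for x y z
  proof -
    have eq: "A (x k) + B w - b + lam *\<^sub>R z k = B w + (A (x k) - b + lam *\<^sub>R z k)" for k w
      by (simp add: algebra_simps)
    show ?thesis unfolding ADM_run_def Ystep_def Xstep_def assms(12) by (simp only: eq)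
  qed
  have PD: "PD_run f g A B b lam u0 um y0 y u \<longleftrightarrow> u 0 = u0 \<and> y 0 = y0 \<and>
      (\<forall>k. y (Suc k) \<in> Ystep (lam *\<^sub>R (2 *\<^sub>R u k - prev um u k) - B (y k)) \<and>
        {u (Suc k)} = Ustep (y (Suc k)) (u k))" for y u
  proof -
    have eq: "B w - B (y k) + lam *\<^sub>R (2 *\<^sub>R u k - prev um u k)
        = B w + (lam *\<^sub>R (2 *\<^sub>R u k - prev um u k) - B (y k))" for k w
      by simp
    show ?thesis unfolding PD_run_def Ystep_def Ustep_def Let_def by (simp only: eq)
  qed
  have dual: "Ustep y u = {u + inverse lam *\<^sub>R (A x + B y - b)}" if "x \<in> Xstep y u" for x y u
  proof -
    have eq: "A v + B y - b = A v + (B y - b)" for v by simp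
    show ?thesis
      using Argmin_dual_step[OF A lam f] that unfolding Ustep_def Xstep_def eq by blast
  qed
  have Ystep_unique: "B y = B y'" if "y \<in> Ystep p" "y' \<in> Ystep p" for y y' p
    using Argmin_quadratic_image_unique[OF g bounded_linear.linear[OF B] lam] that
    unfolding Ystep_def by blast
  have Xstep_ex: "\<exists>x. x \<in> Xstep y u" for y u
  proof -
    have eq: "A v + B y - b + lam *\<^sub>R u = A v + (B y - b + lam *\<^sub>R u)" for v by simp
    \<comment> \<open>The saddle point enters here, through its finite dual value.\<close>
    obtain u' where "\<bar>conjugate f (- adjoint A u')\<bar> \<noteq> \<infinity>"
      using assms(10) unfolding is_saddle_point_def by metis
    from Argmin_primal_step_nonempty[OF A lam assms(6,8) this] show ?thesis
      unfolding Xstep_def eq by blast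
  qed
  have step: "A x = lam *\<^sub>R (u' - u) + b - B y"
    if "u' = u + inverse lam *\<^sub>R (A x + B y - b)" for x y u u'
    using lam that by simp
  \<comment> \<open>With \<open>u\<close> and \<open>v\<close> the current and previous multipliers,
    the identity turns the ADM shift into the extrapolated one: this is the origin of
    \<open>2 *\<^sub>R u - v\<close>.\<close>
  have arg: "A x - b + lam *\<^sub>R u = lam *\<^sub>R (2 *\<^sub>R u - v) - B y"
    if "A x = lam *\<^sub>R (u - v) + b - B y" for x y u v
    unfolding that by (simp add: algebra_simps scaleR_2)
  \<comment> \<open>Using \<open>prev\<close> makes the initialization the case \<open>k = 0\<close>
    of the induction. The runs may choose different \<open>y\<close>-minimizers; only their images
    under \<open>B\<close> are shown to agree.\<close>
  have both: "A (x1 k) = lam *\<^sub>R (u4 k - prev um u4 k) + b - B (y4 k) \<and> z1 k = u4 k"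
    if "ADM_run f g A B b lam x0 z0 x1 y1 z1" and "PD_run f g A B b lam u0 um y0 y4 u4"
    for x1 y1 z1 y4 u4 k
  proof -
    have adm: "x1 0 = x0" "z1 0 = u0" "\<And>k. y1 (Suc k) \<in> Ystep (A (x1 k) - b + lam *\<^sub>R z1 k)"
      "\<And>k. x1 (Suc k) \<in> Xstep (y1 (Suc k)) (z1 k)"
      "\<And>k. z1 (Suc k) = z1 k + inverse lam *\<^sub>R (A (x1 (Suc k)) + B (y1 (Suc k)) - b)"
      using that(1) unfolding ADM by blast+
    have pd: "u4 0 = u0" "y4 0 = y0"
      "\<And>k. y4 (Suc k) \<in> Ystep (lam *\<^sub>R (2 *\<^sub>R u4 k - prev um u4 k) - B (y4 k))"
      "\<And>k. {u4 (Suc k)} = Ustep (y4 (Suc k)) (u4 k)"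
      using that(2) unfolding PD by blast+
    show ?thesis
    proof (induction k)
      case 0
      then show ?case using assms(11) by (simp add: adm(1,2) pd(1,2) prev_def)
    next
      case (Suc k)
      then have Ax: "A (x1 k) = lam *\<^sub>R (u4 k - prev um u4 k) + b - B (y4 k)"
        and z: "z1 k = u4 k" by blast+
      have By: "B (y1 (Suc k)) = B (y4 (Suc k))"
        using adm(3)[of k] pd(3)[of k] unfolding z arg[OF Ax] by (rule Ystep_unique)
      have u: "z1 (Suc k) = u4 k + inverse lam *\<^sub>R (A (x1 (Suc k)) + B (y4 (Suc k)) - b)"
        unfolding adm(5)[of k] z By ..
      have "x1 (Suc k) \<in> Xstep (y4 (Suc k)) (u4 k)"
        using adm(4)[of k] unfolding Xstep_def z By .
      from dual[OF this] have "{u4 (Suc k)} = {z1 (Suc k)}"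
        unfolding pd(4)[of k] u .
      then have "z1 (Suc k) = u4 (Suc k)" by simp
      with step[OF u] show ?case by (simp add: prev_def)
    qed
  qed
  have both_pos: "A (x1 k) = lam *\<^sub>R (u4 k - u4 (k - 1)) + b - B (y4 k)" "z1 k = u4 k"
    if "ADM_run f g A B b lam x0 z0 x1 y1 z1" "PD_run f g A B b lam u0 um y0 y4 u4" "k > 0"
    for x1 y1 z1 y4 u4 k
    using both[OF that(1,2), of k] that(3) by (cases k; simp add: prev_def)+
  have to_PD: "PD_run f g A B b lam u0 um y0 (y1(0 := y0)) z1"
    if run: "ADM_run f g A B b lam x0 z0 x1 y1 z1" for x1 y1 z1
  proof -
    have adm: "x1 0 = x0" "z1 0 = u0" "\<And>k. y1 (Suc k) \<in> Ystep (A (x1 k) - b + lam *\<^sub>R z1 k)"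
      "\<And>k. x1 (Suc k) \<in> Xstep (y1 (Suc k)) (z1 k)"
      and z: "\<And>k. z1 (Suc k) = z1 k + inverse lam *\<^sub>R (A (x1 (Suc k)) + B (y1 (Suc k)) - b)"
      using run unfolding ADM by blast+
    \<comment> \<open>Only the starting value changes, since the primal-dual run must begin at
      \<open>y0\<close>.\<close>
    define y4 where "y4 = y1(0 := y0)"
    have y4: "y4 0 = y0" "y4 (Suc k) = y1 (Suc k)" for k by (simp_all add: y4_def)
    have Ax: "A (x1 k) = lam *\<^sub>R (z1 k - prev um z1 k) + b - B (y4 k)" for k
    proof (cases k)
      case 0
      then show ?thesis using assms(11) by (simp add: adm(1,2) prev_def y4)
    next
      case (Suc j)
      then show ?thesis using step[OF z[of j]] by (simp add: prev_def y4)
    qed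
    have "y4 (Suc k) \<in> Ystep (lam *\<^sub>R (2 *\<^sub>R z1 k - prev um z1 k) - B (y4 k))" for k
      using adm(3)[of k] unfolding arg[OF Ax] y4 .
    moreover have "{z1 (Suc k)} = Ustep (y4 (Suc k)) (z1 k)" for k
      unfolding y4 dual[OF adm(4)] z ..
    ultimately show ?thesis
      using adm(2) y4(1) unfolding PD y4_def[symmetric] by blast
  qed
  have to_ADM: "\<exists>x1. ADM_run f g A B b lam x0 z0 x1 y4 u4"
    if run: "PD_run f g A B b lam u0 um y0 y4 u4" for y4 u4
  proof -
    have pd: "u4 0 = u0" "y4 0 = y0"
      "\<And>k. y4 (Suc k) \<in> Ystep (lam *\<^sub>R (2 *\<^sub>R u4 k - prev um u4 k) - B (y4 k))"
      "\<And>k. {u4 (Suc k)} = Ustep (y4 (Suc k)) (u4 k)"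
      using run unfolding PD by blast+
    \<comment> \<open>\<open>X k\<close> will be the ADM iterate of index \<open>k + 1\<close>; any
      primal minimizer serves.\<close>
    define X where "X k = (SOME x. x \<in> Xstep (y4 (Suc k)) (u4 k))" for k
    have X: "X k \<in> Xstep (y4 (Suc k)) (u4 k)" for k
      unfolding X_def using Xstep_ex by (rule someI_ex)
    define x1 where "x1 k = (case k of 0 \<Rightarrow> x0 | Suc j \<Rightarrow> X j)" for k
    have x1: "x1 0 = x0" "x1 (Suc k) = X k" for k by (simp_all add: x1_def)
    \<comment> \<open>The singleton computed by \<open>dual\<close> forces the given dual iterate to
      be the multiplier update for the chosen \<open>X k\<close>.\<close>
    have u: "u4 (Suc k) = u4 k + inverse lam *\<^sub>R (A (x1 (Suc k)) + B (y4 (Suc k)) - b)" for k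
      using pd(4)[of k] unfolding dual[OF X] x1 by blast
    have Ax: "A (x1 k) = lam *\<^sub>R (u4 k - prev um u4 k) + b - B (y4 k)" for k
    proof (cases k)
      case 0
      then show ?thesis using assms(11) by (simp add: x1(1) pd(1,2) prev_def)
    next
      case (Suc j)
      then show ?thesis using step[OF u[of j]] by (simp add: prev_def)
    qed
    have "y4 (Suc k) \<in> Ystep (A (x1 k) - b + lam *\<^sub>R u4 k)" for k
      unfolding arg[OF Ax] by (rule pd(3))
    moreover have "x1 (Suc k) \<in> Xstep (y4 (Suc k)) (u4 k)" for k
      unfolding x1 by (rule X)
    ultimately have "ADM_run f g A B b lam x0 z0 x1 y4 u4"
      using x1(1) pd(1) u unfolding ADM by blast
    then show ?thesis by blast
  qed
  show ?thesis
  proof (intro conjI allI impI; (elim conjE)?)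
    fix x1 y1 z1 y4 u4 and k :: nat
    assume "ADM_run f g A B b lam x0 z0 x1 y1 z1" "PD_run f g A B b lam u0 um y0 y4 u4" "k > 0"
    note both_pos[OF this]
    then show "A (x1 k) = lam *\<^sub>R (u4 k - u4 (k - 1)) + b - B (y4 k)" "z1 k = u4 k" .
  next
    fix x1 y1 z1
    assume run: "ADM_run f g A B b lam x0 z0 x1 y1 z1"
    show "\<exists>y4 u4. PD_run f g A B b lam u0 um y0 y4 u4 \<and>
        (\<forall>k>0. y4 k = y1 k \<and>
          A (x1 k) = lam *\<^sub>R (u4 k - u4 (k - 1)) + b - B (y4 k) \<and> z1 k = u4 k)"
      using to_PD[OF run] both_pos(1)[OF run to_PD[OF run]]
      by (intro exI[of _ "y1(0 := y0)"] exI[of _ z1]) simp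
  next
    fix y4 u4
    assume run: "PD_run f g A B b lam u0 um y0 y4 u4"
    then obtain x1 where "ADM_run f g A B b lam x0 z0 x1 y4 u4" using to_ADM by blast
    then show "\<exists>x1 y1 z1. ADM_run f g A B b lam x0 z0 x1 y1 z1 \<and>
        (\<forall>k>0. y1 k = y4 k \<and>
          A (x1 k) = lam *\<^sub>R (u4 k - u4 (k - 1)) + b - B (y4 k) \<and> z1 k = u4 k)"
      using both_pos(1)[OF _ run] by blast
  qed
qed

end
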